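(* Let $X$ be a linear space and $(Y,N)$ a fuzzy Banach space. Let $\varphi:X^3\to[0,\infty)$ be a function such that $$\tilde\varphi(x,y,z)=\sum_{n=0}^{\infty}\frac{1}{3^n}\varphi(3^nx,3^ny,3^nz)<\infty\quad\text{for all }x,y,z\in X.$$ Let $f:X\to Y$ be a uniformly approximately affine mapping with respect to $\varphi$, i.e., $$\lim_{t\to\infty}N(Df(x,y,z),t\varphi(x,y,z))=1\quad\text{uniformly on }X^3.$$ Then there is a unique affine mapping $A:X\to Y$ such that $$\lim_{t\to\infty}N(f(x)-A(x)-f(0),t\tilde\varphi(0,0,x))=1\quad\text{uniformly on }X.$$
   Context: For a mapping $f:X\to Y$, $$Df(x,y,z)=f(3x+y+z)+f(x+3y+z)+f(x+y+3z)+f(x)+f(y)+f(z)-6f(x+y+z).$$ A mapping between linear spaces is affine if it is the sum of a constant and an additive function (a function $a$ with $a(u+v)=a(u)+a(v)$ for all $u,v$). A fuzzy norm on a real linear space $X$ is a mapping $N:X\times\mathbb{R}\to[0,1]$ such that for all $x,y\in X$ and $s,t\in\mathbb{R}$: (N1) $N(x,t)=0$ for $t\le 0$; (N2) $x=0$ if and only if $N(x,t)=1$ for all $t>0$; (N3) $N(cx,t)=N(x,t/|c|)$ if $c\ne 0$; (N4) $N(x+y,t+s)\ge\min\{N(x,t),N(y,s)\}$; (N5) $N(x,\cdot)$ is non-decreasing on $\mathbb{R}$ and $\lim_{t\to\infty}N(x,t)=1$; (N6) for $x\ne 0$, $N(x,\cdot)$ is continuous on $\mathbb{R}$. The pair $(X,N)$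 is then called a fuzzy normed (linear) space. A sequence $\{x_n\}$ in $(X,N)$ is convergent if there is $x\in X$ with $\lim_{n\to\infty}N(x_n-x,t)=1$ for all $t>0$. It is Cauchy if for every $\varepsilon>0$ and $\delta>0$ there is $n_0\in\mathbb{N}$ with $N(x_m-x_n,\delta)>1-\varepsilon$ for all $m,n\ge n_0$. A fuzzy Banach space is a fuzzy normed space in which every Cauchy sequence is convergent. The uniform limits mean: for every $\varepsilon>0$ there is $t_0>0$ such that the quantity in question is $\ge 1-\varepsilon$ for all $t\ge t_0$ and all points of $X^3$ (respectively $X$).
   Formalization: Uniqueness among all affine A fails (φ=1, f=0, X=Y=ℝ, N(x,t)=t/(t+|x|) for t>0: every constant A works); the formal theorem instead states that A is unique subject to A(0)=0, and that any two affine mappings with the approximation property differ by an additive constant. *)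

theory Defs
  imports Complex_Main
begin

locale fuzzy_norm =
  fixes N :: "'b::real_vector \<Rightarrow> real \<Rightarrow> real"
  assumes range: "N x t \<in> {0..1}"
    and N1: "t \<le> 0 \<Longrightarrow> N x t = 0"
    and N2: "x = 0 \<longleftrightarrow> (\<forall>t>0. N x t = 1)"
    and N3: "c \<noteq> 0 \<Longrightarrow> N (c *\<^sub>R x) t = N x (t / \<bar>c\<bar>)"
    and N4: "N (x + y) (t + s) \<ge> min (N x t) (N y s)"
    and N5_mono: "mono (N x)"
    and N5_lim: "(N x \<longlongrightarrow> 1) at_top"
    and N6: "x \<noteq> 0 \<Longrightarrow> continuous_on UNIV (N x)"
begin

definition fconverges :: "(nat \<Rightarrow> 'b) \<Rightarrow> 'b \<Rightarrow> bool" where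
  "fconverges X x \<longleftrightarrow> (\<forall>t>0. (\<lambda>n. N (X n - x) t) \<longlonglongrightarrow> 1)"

definition fconvergent :: "(nat \<Rightarrow> 'b) \<Rightarrow> bool" where
  "fconvergent X \<longleftrightarrow> (\<exists>x. fconverges X x)"

definition fCauchy :: "(nat \<Rightarrow> 'b) \<Rightarrow> bool" where
  "fCauchy X \<longleftrightarrow>
    (\<forall>\<epsilon>>0. \<forall>\<delta>>0. \<exists>n0. \<forall>m\<ge>n0. \<forall>n\<ge>n0. N (X m - X n) \<delta> > 1 - \<epsilon>)"

end

locale fuzzy_banach = fuzzy_norm +
  assumes complete: "fCauchy X \<Longrightarrow> fconvergent X"

definition Dop :: "('a::real_vector \<Rightarrow> 'b::real_vector) \<Rightarrow> 'a \<Rightarrow> 'a \<Rightarrow> 'a \<Rightarrow> 'b" where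
  "Dop f x y z =
     f (3 *\<^sub>R x + y + z) + f (x + 3 *\<^sub>R y + z) + f (x + y + 3 *\<^sub>R z)
     + f x + f y + f z - 6 *\<^sub>R f (x + y + z)"

text \<open>Affine here means affine over the integers: the additive part need not be real-linear.
  Constants count as affine, so when \<open>phi_tilde \<phi> 0 0\<close> is bounded away from 0, adding a constant
  to an affine approximant gives another one. Uniqueness therefore holds only up to an additive
  constant, or under the normalisation \<open>A 0 = 0\<close>.\<close>

definition affine_map :: "('a::real_vector \<Rightarrow> 'b::real_vector) \<Rightarrow> bool" where
  "affine_map A \<longleftrightarrow> (\<exists>c a. Modules.additive a \<and> (\<forall>x. A x = c + a x))"

text \<open>\<open>q t p\<close> tends to 1 as \<open>t\<close> grows, uniformly in the point \<open>p\<close>. A one-sided bound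
  suffices because it is applied only to quantities bounded above by 1.\<close>

definition unif_tendsto_1 :: "(real \<Rightarrow> 'p \<Rightarrow> real) \<Rightarrow> bool" where
  "unif_tendsto_1 q \<longleftrightarrow> (\<forall>\<epsilon>>0. \<exists>t0>0. \<forall>t\<ge>t0. \<forall>p. q t p \<ge> 1 - \<epsilon>)"

definition phi_term ::
  "('a::real_vector \<Rightarrow> 'a \<Rightarrow> 'a \<Rightarrow> real) \<Rightarrow> 'a \<Rightarrow> 'a \<Rightarrow> 'a \<Rightarrow> nat \<Rightarrow> real" where
  "phi_term \<phi> x y z n = 1 / 3 ^ n * \<phi> (3 ^ n *\<^sub>R x) (3 ^ n *\<^sub>R y) (3 ^ n *\<^sub>R z)"

definition phi_tilde ::
  "('a::real_vector \<Rightarrow> 'a \<Rightarrow> 'a \<Rightarrow> real) \<Rightarrow> 'a \<Rightarrow> 'a \<Rightarrow> 'a \<Rightarrow> real" where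
  "phi_tilde \<phi> x y z = (\<Sum>n. phi_term \<phi> x y z n)"

definition unif_approx_affine ::
  "('b::real_vector \<Rightarrow> real \<Rightarrow> real) \<Rightarrow> ('a::real_vector \<Rightarrow> 'a \<Rightarrow> 'a \<Rightarrow> real)
    \<Rightarrow> ('a \<Rightarrow> 'b) \<Rightarrow> bool" where
  "unif_approx_affine N \<phi> f \<longleftrightarrow>
     unif_tendsto_1 (\<lambda>t (x, y, z). N (Dop f x y z) (t * \<phi> x y z))"

definition unif_approximates ::
  "('b::real_vector \<Rightarrow> real \<Rightarrow> real) \<Rightarrow> ('a::real_vector \<Rightarrow> 'a \<Rightarrow> 'a \<Rightarrow> real)
    \<Rightarrow> ('a \<Rightarrow> 'b) \<Rightarrow> ('a \<Rightarrow> 'b) \<Rightarrow> bool" where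
  "unif_approximates N \<phi> f A \<longleftrightarrow>
     unif_tendsto_1 (\<lambda>t x. N (f x - A x - f 0) (t * phi_tilde \<phi> 0 0 x))"

end

theory Submission
  imports Defs
begin

text \<open>
  Put \<open>g = f - f 0\<close>. Then \<open>Dop f 0 0 x = g (3x) - 3 g x\<close>, so the sequence \<open>g (3^n x) / 3^n\<close>
  is Cauchy by telescoping, and its limit \<open>A x\<close> stays within the partial sums of \<open>phi_tilde\<close>.
  Passing to the limit in the hypothesis gives \<open>Dop A = 0\<close> with \<open>A 0 = 0\<close>. For such \<open>A\<close>,
  triples of sum zero show that \<open>h x = A (2x) + A x\<close> is additive, and the triple \<open>(x, x, 0)\<close>
  gives \<open>3 A = h\<close>. Uniqueness follows by dividing the difference of two approximants at
  \<open>3^n x\<close> by \<open>3^n\<close>, since \<open>phi_tilde \<phi> 0 0 (3^n x) / 3^n\<close> is a tail of a convergent series.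
\<close>

section \<open>Elementary estimates and limits in a fuzzy normed space\<close>

context fuzzy_norm
begin

lemma N_le_1: "N x t \<le> 1"
  using range[of x t] by simp

lemma N_mono: "s \<le> t \<Longrightarrow> N x s \<le> N x t"
  using N5_mono[of x] by (simp add: mono_def)

lemma N_zero: "t > 0 \<Longrightarrow> N 0 t = 1"
  using N2[of 0] by simp

lemma N_minus: "N (- x) t = N x t"
  using N3[of "-1" x t] by simp

lemma N_minus_commute: "N (x - y) t = N (y - x) t"
  using N_minus[of "x - y" t] by simp

lemma N_scaleR_pos: "c > 0 \<Longrightarrow> N (c *\<^sub>R x) (c * t) = N x t"
  using N3[of c x "c * t"] by simp

text \<open>The minimum in \<open>N4\<close> lets one bound \<open>b\<close> survive addition: the
  scale parameters add up, the errors do not.\<close>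

lemma N_add_ge: "N x t \<ge> b \<Longrightarrow> N y s \<ge> b \<Longrightarrow> N (x + y) (t + s) \<ge> b"
  using N4[of x t y s] by linarith

lemma eq_0_if_N_ge:
  assumes "\<And>t e. t > 0 \<Longrightarrow> e > 0 \<Longrightarrow> N x t \<ge> 1 - e"
  shows "x = 0"
proof -
  have "N x t = 1" if "t > 0" for t
  proof (rule antisym)
    show "1 \<le> N x t"
      by (rule field_le_epsilon) (use assms[OF that] in \<open>force simp: algebra_simps\<close>)
  qed (rule N_le_1)
  then show ?thesis using N2 by blast
qed

text \<open>Since \<open>N\<close> never exceeds 1, only a lower bound is at stake, and bounds of
  the form \<open>1 - e\<close> combine by \<open>N_add_ge\<close>.\<close>

lemma fconverges_iff:
  "fconverges X x \<longleftrightarrow> (\<forall>t>0. \<forall>e>0. \<forall>\<^sub>F n in sequentially. N (X n - x) t \<ge> 1 - e)"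
proof
  assume L: "fconverges X x"
  show "\<forall>t>0. \<forall>e>0. \<forall>\<^sub>F n in sequentially. N (X n - x) t \<ge> 1 - e"
  proof (intro allI impI)
    fix t e :: real assume "t > 0" "e > 0"
    then have "(\<lambda>n. N (X n - x) t) \<longlonglongrightarrow> 1" "1 - e < 1"
      using L by (auto simp: fconverges_def)
    from order_tendstoD(1)[OF this] show "\<forall>\<^sub>F n in sequentially. N (X n - x) t \<ge> 1 - e"
      by eventually_elim simp
  qed
next
  assume R: "\<forall>t>0. \<forall>e>0. \<forall>\<^sub>F n in sequentially. N (X n - x) t \<ge> 1 - e"
  show "fconverges X x" unfolding fconverges_def
  proof (intro allI impI)
    fix t :: real assume t: "t > 0"
    show "(\<lambda>n. N (X n - x) t) \<longlonglongrightarrow> 1"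
    proof (rule order_tendstoI)
      fix a :: real assume "a < 1"
      then have "\<forall>\<^sub>F n in sequentially. N (X n - x) t \<ge> 1 - (1 - a) / 2"
        using R t by simp
      then show "\<forall>\<^sub>F n in sequentially. a < N (X n - x) t"
        by eventually_elim (use \<open>a < 1\<close> in \<open>simp add: field_simps\<close>)
    next
      fix a :: real assume "1 < a"
      then show "\<forall>\<^sub>F n in sequentially. N (X n - x) t < a"
        by (intro always_eventually allI le_less_trans[OF N_le_1])
    qed
  qed
qed

lemma fconverges_const: "fconverges (\<lambda>_. x) x"
  by (simp add: fconverges_iff N_zero)

lemma fconverges_add:
  assumes "fconverges X x" "fconverges Y y"
  shows "fconverges (\<lambda>n. X n + Y n) (x + y)"
  unfolding fconverges_iff
proof (intro allI impI)
  fix t e :: real assume "t > 0" "e > 0"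
  then have "\<forall>\<^sub>F n in sequentially. N (X n - x) (t/2) \<ge> 1 - e"
    "\<forall>\<^sub>F n in sequentially. N (Y n - y) (t/2) \<ge> 1 - e"
    using assms by (simp_all add: fconverges_iff)
  then show "\<forall>\<^sub>F n in sequentially. N (X n + Y n - (x + y)) t \<ge> 1 - e"
  proof eventually_elim
    case (elim n)
    from N_add_ge[OF this] show ?case by (simp add: algebra_simps)
  qed
qed

lemma fconverges_scaleR:
  assumes "fconverges X x"
  shows "fconverges (\<lambda>n. c *\<^sub>R X n) (c *\<^sub>R x)"
proof (cases "c = 0")
  case False
  have "N (c *\<^sub>R X n - c *\<^sub>R x) t = N (X n - x) (t / \<bar>c\<bar>)" for n t
    using N3[OF False, of "X n - x" t] by (simp add: scaleR_diff_right)
  then show ?thesis using assms False by (simp add: fconverges_iff)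
qed (simp add: fconverges_const)

lemma fconverges_diff:
  assumes "fconverges X x" "fconverges Y y"
  shows "fconverges (\<lambda>n. X n - Y n) (x - y)"
  using fconverges_add[OF assms(1) fconverges_scaleR[OF assms(2), of "-1"]] by simp

lemma fconverges_unique:
  assumes "fconverges X x" "fconverges X y"
  shows "x = y"
proof -
  have "x - y = 0"
  proof (rule eq_0_if_N_ge)
    fix t e :: real assume "t > 0" "e > 0"
    with fconverges_diff[OF assms] have "\<forall>\<^sub>F n in sequentially. N (X n - X n - (x - y)) t \<ge> 1 - e"
      unfolding fconverges_iff by blast
    then have "N (- (x - y)) t \<ge> 1 - e" by simp
    then show "N (x - y) t \<ge> 1 - e" by (simp only: N_minus)
  qed
  then show ?thesis by simp
qed

lemma fconverges_Dop:
  assumes "\<And>x. fconverges (\<lambda>n. F n x) (A x)"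
  shows "fconverges (\<lambda>n. Dop (F n) x y z) (Dop A x y z)"
  unfolding Dop_def
  by (intro fconverges_add fconverges_diff fconverges_scaleR assms)

text \<open>For a given \<open>e\<close> one \<open>t\<close> serves all \<open>n\<close>, so
  \<open>t * r n\<close> eventually falls below any fixed \<open>s > 0\<close>, and \<open>N\<close>
  is monotone in its second argument.\<close>

lemma fconverges_0_if_N_ge:
  assumes "\<And>e. e > 0 \<Longrightarrow> \<exists>t. \<forall>n. N (u n) (t * r n) \<ge> 1 - e" and r: "r \<longlonglongrightarrow> 0"
  shows "fconverges u 0"
  unfolding fconverges_iff
proof (intro allI impI)
  fix s e :: real assume "s > 0" "e > 0"
  then obtain t where t: "\<And>n. N (u n) (t * r n) \<ge> 1 - e" using assms(1) by blast
  have "(\<lambda>n. t * r n) \<longlonglongrightarrow> 0" using tendsto_mult_right_zero[OF r] .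
  from order_tendstoD(2)[OF this \<open>s > 0\<close>]
  show "\<forall>\<^sub>F n in sequentially. N (u n - 0) s \<ge> 1 - e"
  proof eventually_elim
    case (elim n)
    then show ?case using t[of n] N_mono[of "t * r n" s "u n"] by simp
  qed
qed

lemma fconverges_scaleR_0:
  assumes c: "\<And>n. c n > 0" "c \<longlonglongrightarrow> (0::real)"
  shows "fconverges (\<lambda>n. c n *\<^sub>R x) 0"
proof (rule fconverges_0_if_N_ge[OF _ c(2)])
  fix e :: real assume "e > 0"
  then have "\<forall>\<^sub>F t in at_top. N x t > 1 - e"
    by (intro order_tendstoD(1)[OF N5_lim]) simp
  then obtain t where "N x t > 1 - e"
    using eventually_at_top_linorder by (metis order_refl)
  then show "\<exists>t. \<forall>n. N (c n *\<^sub>R x) (t * c n) \<ge> 1 - e"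
    using N_scaleR_pos[OF c(1)] by (intro exI[of _ t]) (simp add: mult.commute less_imp_le)
qed

text \<open>Repeated \<open>N_add_ge\<close> keeps the bound \<open>b\<close> however many steps are
  added. For \<open>m = n\<close> the left side would be \<open>N 0 0 = 0\<close>, hence the strict
  \<open>m < n\<close>.\<close>

lemma N_telescope_ge:
  assumes step: "\<And>k. N (X (Suc k) - X k) (t * a k) \<ge> b"
    and "m < n"
  shows "N (X n - X m) (t * (\<Sum>k=m..<n. a k)) \<ge> b"
  using \<open>m < n\<close>
proof (induction n)
  case (Suc n)
  show ?case
  proof (cases "m = n")
    case True
    then show ?thesis using step[of n] by simp
  next
    case False
    with Suc have "m < n" "N (X n - X m) (t * sum a {m..<n}) \<ge> b" by simp_all
    from N_add_ge[OF this(2) step[of n]] \<open>m < n\<close> show ?thesis by (simp add: algebra_simps)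
  qed
qed simp

lemma fCauchy_if_N_step_ge:
  assumes step: "\<And>e. e > 0 \<Longrightarrow> \<exists>t. \<forall>k. N (X (Suc k) - X k) (t * a k) \<ge> 1 - e"
    and a: "summable a"
  shows "fCauchy X"
  unfolding fCauchy_def
proof (intro allI impI)
  fix e d :: real assume e: "e > 0" and d: "d > 0"
  \<comment> \<open>Halving \<open>e\<close> turns the weak bound of the telescoping into the strict
    one in \<open>fCauchy_def\<close>.\<close>
  then obtain t where t: "\<And>k. N (X (Suc k) - X k) (t * a k) \<ge> 1 - e / 2"
    using step[of "e / 2"] by auto
  \<comment> \<open>The \<open>+ 1\<close> keeps the divisor positive even for
    \<open>t = 0\<close>.\<close>
  have "d / (\<bar>t\<bar> + 1) > 0" using d by simp
  then obtain n0 where n0: "\<And>m n. m \<ge> n0 \<Longrightarrow> \<bar>\<Sum>k=m..<n. a k\<bar> < d / (\<bar>t\<bar> + 1)"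
    using a unfolding summable_Cauchy real_norm_def by blast
  have lt: "N (X n - X m) d > 1 - e" if "n0 \<le> m" "m < n" for m n
  proof -
    have "t * (\<Sum>k=m..<n. a k) \<le> (\<bar>t\<bar> + 1) * \<bar>\<Sum>k=m..<n. a k\<bar>"
      by (rule order_trans[OF abs_ge_self]) (auto simp: abs_mult intro: mult_right_mono)
    also have "\<dots> \<le> d" using n0[OF that(1), of n] by (simp add: field_simps)
    finally have "N (X n - X m) d \<ge> N (X n - X m) (t * (\<Sum>k=m..<n. a k))" by (rule N_mono)
    with N_telescope_ge[where X = X and a = a, OF t that(2)] e show ?thesis by linarith
  qed
  show "\<exists>n0. \<forall>m\<ge>n0. \<forall>n\<ge>n0. N (X m - X n) d > 1 - e"
  proof (intro exI allI impI)
    fix m n assume "n0 \<le> m" "n0 \<le> n"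
    then show "N (X m - X n) d > 1 - e"
      using lt[of m n] lt[of n m] N_zero[OF d] e N_minus_commute[of "X m" "X n" d]
      by (cases m n rule: linorder_cases) simp_all
  qed
qed

text \<open>The slack \<open>t - s\<close> pays for the distance from a late term of
  \<open>X\<close> to its limit. The bound is asked only at \<open>Suc n\<close> because a
  telescoping estimate from index 0 has at least one step.\<close>

lemma N_limit_ge:
  assumes X: "fconverges X x" and b: "\<And>n. N (X (Suc n) - y) s \<ge> 1 - e"
    and "s < t" "e > 0"
  shows "N (y - x) t \<ge> 1 - e"
proof -
  have "\<forall>\<^sub>F n in sequentially. N (X n - x) (t - s) \<ge> 1 - e"
    using X assms(3,4) by (simp add: fconverges_iff)
  then obtain n0 where "\<forall>n\<ge>n0. N (X n - x) (t - s) \<ge> 1 - e"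
    unfolding eventually_sequentially by blast
  then have "N (X (Suc n0) - x) (t - s) \<ge> 1 - e" by simp
  moreover have "N (y - X (Suc n0)) s \<ge> 1 - e" using b[of n0] by (simp add: N_minus_commute)
  ultimately show ?thesis
    using N_add_ge[of "1 - e" "X (Suc n0) - x" "t - s" "y - X (Suc n0)" s] by simp
qed

end

section \<open>The functional equation \<open>Dop A = 0\<close> and the algebra of
  \<open>Dop\<close>\<close>

lemma scaleR_3: "3 *\<^sub>R x = x + x + x"
  for x :: "'a::real_vector"
  using scaleR_left_distrib[of 2 1 x] by (simp add: scaleR_2)

lemma scaleR_6: "6 *\<^sub>R x = 3 *\<^sub>R x + (x + x + x)"
  for x :: "'a::real_vector"
  using scaleR_left_distrib[of 3 3 x] by (simp add: scaleR_3)

lemma additive_if_Dop_eq_0: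
  assumes D: "\<And>x y z. Dop A x y z = 0" and A0: "A 0 = 0"
  shows "Modules.additive A"
proof -
  define h where "h x = A (2 *\<^sub>R x) + A x" for x
  \<comment> \<open>With \<open>z = - (x + y)\<close> the term \<open>A (x + y + z)\<close> vanishes
    and each argument such as \<open>3x + y + z\<close> collapses to \<open>2x\<close>.\<close>
  have h: "h x + h y + h (- (x + y)) = 0" for x y
  proof -
    have "3 *\<^sub>R x + y + - (x + y) = 2 *\<^sub>R x" "x + 3 *\<^sub>R y + - (x + y) = 2 *\<^sub>R y"
      "x + y + 3 *\<^sub>R (- (x + y)) = 2 *\<^sub>R (- (x + y))"
      by (simp_all add: algebra_simps scaleR_2 scaleR_3)
    then show ?thesis using D[of x y "- (x + y)"] A0 unfolding Dop_def h_def
      by (simp add: algebra_simps)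
  qed
  have h0: "h 0 = 0" by (simp add: h_def A0)
  \<comment> \<open>The instance \<open>(x + y, 0)\<close> shows that \<open>h (- (x + y))\<close>
    is the negative of \<open>h (x + y)\<close>.\<close>
  have h_add: "h (x + y) = h x + h y" for x y
    using h[of x y] h[of "x + y" 0] h0
    by (metis add.right_neutral add_right_cancel)
  \<comment> \<open>The triple \<open>(x, x, 0)\<close> relates \<open>A (4x)\<close>,
    \<open>A (2x)\<close> and \<open>A x\<close>. Substituting \<open>A (2x) = h x - A x\<close> and
    \<open>A (4x) = h x + A x\<close> yields \<open>3 h + 3 A = 6 h - 6 A\<close> at
    \<open>x\<close>.\<close>
  have A_eq: "9 *\<^sub>R A x = 3 *\<^sub>R h x" for x
  proof -
    have *: "3 *\<^sub>R x + x + 0 = 4 *\<^sub>R x" "x + 3 *\<^sub>R x + 0 = 4 *\<^sub>R x" "x + x + 3 *\<^sub>R 0 = 2 *\<^sub>R x"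
        "x + x + 0 = 2 *\<^sub>R x"
      using scaleR_left_distrib[of 3 1 x] scaleR_left_distrib[of 1 3 x]
      by (simp_all add: scaleR_2)
    have E: "A (4 *\<^sub>R x) + A (4 *\<^sub>R x) + A (2 *\<^sub>R x) + A x + A x = 6 *\<^sub>R A (2 *\<^sub>R x)"
      using D[of x x 0] unfolding Dop_def * A0 by simp
    have "h (2 *\<^sub>R x) = h x + h x" by (simp add: scaleR_2 h_add)
    then have A4: "A (4 *\<^sub>R x) = h x + h x - A (2 *\<^sub>R x)" by (simp add: h_def algebra_simps)
    have A2: "A (2 *\<^sub>R x) = h x - A x" by (simp add: h_def)
    have "9 *\<^sub>R A x = 6 *\<^sub>R A x + 3 *\<^sub>R A x"
      using scaleR_left_distrib[of 6 3 "A x"] by simp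
    with E show ?thesis unfolding A4 A2 by (simp add: scaleR_6 scaleR_3 algebra_simps)
  qed
  have "A x = (1/3) *\<^sub>R h x" for x
    using arg_cong[OF A_eq[of x], of "\<lambda>v. (1/9) *\<^sub>R v"] by simp
  then show ?thesis by (intro Modules.additive.intro) (simp add: h_add scaleR_add_right)
qed

text \<open>An additive map need not be real-linear, but tripling is repeated addition.\<close>

lemma additive_scaleR_3_power:
  fixes a :: "'u::real_vector \<Rightarrow> 'v::real_vector"
  assumes "Modules.additive a"
  shows "a (3 ^ n *\<^sub>R x) = 3 ^ n *\<^sub>R a x"
proof (induction n)
  case (Suc n)
  have "a (3 *\<^sub>R y) = 3 *\<^sub>R a y" for y
    by (simp add: scaleR_3 Modules.additive.add[OF assms])
  with Suc show ?case by (metis power_Suc scaleR_scaleR)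
qed simp

text \<open>The coefficients of \<open>Dop\<close> sum to zero: six ones against -6.\<close>

lemma Dop_diff_const: "Dop (\<lambda>x. f x - c) x y z = Dop f x y z"
  by (simp add: Dop_def scaleR_6 scaleR_3 algebra_simps)

lemma Dop_rescale:
  "Dop (\<lambda>x. c *\<^sub>R g (d *\<^sub>R x)) x y z = c *\<^sub>R Dop g (d *\<^sub>R x) (d *\<^sub>R y) (d *\<^sub>R z)"
  by (simp add: Dop_def algebra_simps)

lemma Dop_0_0:
  assumes "g 0 = 0"
  shows "Dop g 0 0 x = g (3 *\<^sub>R x) - 3 *\<^sub>R g x"
  using assms by (simp add: Dop_def scaleR_6)

section \<open>Tails and positivity of the control series\<close>

lemma phi_tilde_rescale_tendsto_0:
  assumes "\<And>x y z. summable (phi_term \<phi> x y z)"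
  shows "(\<lambda>n. 1 / 3 ^ n * phi_tilde \<phi> (3 ^ n *\<^sub>R x) (3 ^ n *\<^sub>R y) (3 ^ n *\<^sub>R z)) \<longlonglongrightarrow> 0"
proof -
  have "1 / 3 ^ n * phi_tilde \<phi> (3 ^ n *\<^sub>R x) (3 ^ n *\<^sub>R y) (3 ^ n *\<^sub>R z)
      = (\<Sum>k. phi_term \<phi> x y z (k + n))" for n
  proof -
    \<comment> \<open>Rescaling the point by \<open>3 ^ n\<close> shifts the series by
      \<open>n\<close> terms.\<close>
    have "phi_term \<phi> x y z (k + n)
        = 1 / 3 ^ n * phi_term \<phi> (3 ^ n *\<^sub>R x) (3 ^ n *\<^sub>R y) (3 ^ n *\<^sub>R z) k" for k
      by (simp add: phi_term_def power_add)
    then show ?thesis by (simp only: phi_tilde_def suminf_mult[OF assms])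
  qed
  moreover have "(\<Sum>k. phi_term \<phi> x y z (k + n)) = suminf (phi_term \<phi> x y z) - (\<Sum>k<n. phi_term \<phi> x y z k)" for n
    by (rule suminf_minus_initial_segment[OF assms])
  moreover have "(\<lambda>n. suminf (phi_term \<phi> x y z) - (\<Sum>k<n. phi_term \<phi> x y z k)) \<longlonglongrightarrow> 0"
    using tendsto_diff[OF tendsto_const[of "suminf (phi_term \<phi> x y z)"]
      summable_LIMSEQ[OF assms[of x y z]]] by simp
  ultimately show ?thesis by simp
qed

text \<open>Strict positivity makes a third of \<open>t * phi_tilde\<close> strictly smaller than
  the whole for \<open>t > 0\<close>, which is the slack that \<open>N_limit_ge\<close>
  consumes.\<close>

lemma phi_tilde_pos:
  assumes "\<And>x y z. \<phi> x y z > 0" "summable (phi_term \<phi> x y z)"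
  shows "phi_tilde \<phi> x y z > 0"
  unfolding phi_tilde_def by (intro suminf_pos assms) (simp add: phi_term_def assms)

section \<open>Positivity of the control function and uniqueness of the additive part\<close>

context fuzzy_norm
begin

text \<open>As \<open>N x 0 = 0\<close>, a zero of \<open>\<phi>\<close> would contradict the uniform limit.\<close>

lemma phi_pos_if_unif_approx_affine:
  assumes "unif_approx_affine N \<phi> f" "\<And>x y z. \<phi> x y z \<ge> 0"
  shows "\<phi> x y z > 0"
proof -
  \<comment> \<open>Any error below 1 would do: it keeps \<open>N\<close> positive at
    \<open>t0\<close>.\<close>
  have "(0::real) < 1/2" by simp
  then obtain t0 where "\<forall>t\<ge>t0. \<forall>p. (case p of (x, y, z) \<Rightarrow> N (Dop f x y z) (t * \<phi> x y z)) \<ge> 1 - 1/2"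
    using assms(1) unfolding unif_approx_affine_def unif_tendsto_1_def by blast
  then have "N (Dop f x y z) (t0 * \<phi> x y z) \<ge> 1/2" by force
  with N1[of "t0 * \<phi> x y z" "Dop f x y z"] have "\<phi> x y z \<noteq> 0" by force
  with assms(2)[of x y z] show ?thesis by linarith
qed

lemma additive_parts_eq:
  assumes sm: "\<And>x y z. summable (phi_term \<phi> x y z)"
    and a: "Modules.additive a" and b: "Modules.additive b"
    and A: "unif_approximates N \<phi> f (\<lambda>x. c + a x)"
    and B: "unif_approximates N \<phi> f (\<lambda>x. d + b x)"
  shows "a = b"
proof
  fix x
  \<comment> \<open>This is the difference of the two approximants at
    \<open>3 ^ n *\<^sub>R x\<close>, divided by \<open>3 ^ n\<close>: the constants are damped,
    while the additive parts stay fixed.\<close>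
  define w where "w n = (1 / 3 ^ n) *\<^sub>R (d - c) + (b x - a x)" for n :: nat
  have "fconverges w 0"
  proof (rule fconverges_0_if_N_ge)
    fix e :: real assume "e > 0"
    then obtain t1 t2 where
      t1: "\<And>t x. t \<ge> t1 \<Longrightarrow> N (f x - (c + a x) - f 0) (t * phi_tilde \<phi> 0 0 x) \<ge> 1 - e" and
      t2: "\<And>t x. t \<ge> t2 \<Longrightarrow> N (f x - (d + b x) - f 0) (t * phi_tilde \<phi> 0 0 x) \<ge> 1 - e"
      using A B unfolding unif_approximates_def unif_tendsto_1_def by metis
    define T where "T = max t1 t2"
    \<comment> \<open>Reversing the sign in the second estimate and adding the first cancels
      \<open>f y\<close> and \<open>f 0\<close>; the two scales \<open>T\<close> add to
      \<open>2 * T\<close>.\<close>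
    have *: "N ((d + b y) - (c + a y)) (2 * T * phi_tilde \<phi> 0 0 y) \<ge> 1 - e" for y
    proof -
      have "N ((d + b y) + f 0 - f y) (T * phi_tilde \<phi> 0 0 y) \<ge> 1 - e"
        using t2[of T y] N_minus[of "f y - (d + b y) - f 0"] by (simp add: T_def algebra_simps)
      from N_add_ge[OF t1[of T y] this] show ?thesis by (simp add: T_def algebra_simps)
    qed
    have "N (w n) (2 * T * (1 / 3 ^ n * phi_tilde \<phi> 0 0 (3 ^ n *\<^sub>R x))) \<ge> 1 - e" for n
    proof -
      have "w n = (1 / 3 ^ n) *\<^sub>R ((d + b (3 ^ n *\<^sub>R x)) - (c + a (3 ^ n *\<^sub>R x)))"
        by (simp add: w_def additive_scaleR_3_power a b algebra_simps)
      then show ?thesis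
        using *[of "3 ^ n *\<^sub>R x"] N_scaleR_pos[of "1 / 3 ^ n"] by (simp add: mult.left_commute)
    qed
    then show "\<exists>t. \<forall>n. N (w n) (t * (1 / 3 ^ n * phi_tilde \<phi> 0 0 (3 ^ n *\<^sub>R x))) \<ge> 1 - e"
      by blast
  next
    show "(\<lambda>n. 1 / 3 ^ n * phi_tilde \<phi> 0 0 (3 ^ n *\<^sub>R x)) \<longlonglongrightarrow> 0"
      using phi_tilde_rescale_tendsto_0[OF sm, of 0 0 x] by simp
  qed
  \<comment> \<open>Directly from its definition \<open>w\<close> has the limit
    \<open>b x - a x\<close>, which must then equal the limit 0 found above.\<close>
  moreover have "fconverges w (0 + (b x - a x))"
    unfolding w_def
  proof (intro fconverges_add fconverges_const fconverges_scaleR_0)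
    show "(\<lambda>n. 1 / 3 ^ n :: real) \<longlonglongrightarrow> 0"
      using LIMSEQ_power_zero[of "1/3 :: real"] by (simp add: power_one_over)
  qed simp
  ultimately show "a x = b x" using fconverges_unique by fastforce
qed

end

section \<open>Existence of an additive approximant as the limit of rescalings of
  \<open>f\<close>\<close>

context fuzzy_banach
begin

lemma ex_additive_approximant:
  assumes nonneg: "\<And>x y z. \<phi> x y z \<ge> 0"
    and sm: "\<And>x y z. summable (phi_term \<phi> x y z)"
    and f: "unif_approx_affine N \<phi> f"
  shows "\<exists>A. Modules.additive A \<and> unif_approximates N \<phi> f A"
proof -
  have pos: "\<phi> x y z > 0" for x y z
    by (rule phi_pos_if_unif_approx_affine[OF f nonneg])
  define g where "g = (\<lambda>x. f x - f 0)"
  define F where "F n x = (1 / 3 ^ n) *\<^sub>R g (3 ^ n *\<^sub>R x)" for n :: nat and x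
  \<comment> \<open>The hypothesis at the point scaled by \<open>3 ^ n\<close>, divided by
    \<open>3 ^ n\<close>, turns \<open>\<phi>\<close> into \<open>phi_term\<close> at
    \<open>n\<close>. Uniformity provides one \<open>t0\<close> for all \<open>n\<close> and all
    points.\<close>
  have ND: "\<exists>t0>0. \<forall>t\<ge>t0. \<forall>n x y z. N (Dop (F n) x y z) (t * phi_term \<phi> x y z n) \<ge> 1 - e"
    if "e > 0" for e
  proof -
    obtain t0 where t0: "t0 > 0"
      "\<forall>t\<ge>t0. \<forall>p. (case p of (x, y, z) \<Rightarrow> N (Dop f x y z) (t * \<phi> x y z)) \<ge> 1 - e"
      using f \<open>e > 0\<close> unfolding unif_approx_affine_def unif_tendsto_1_def by blast
    have "N (Dop (F n) x y z) (t * phi_term \<phi> x y z n) \<ge> 1 - e" if "t \<ge> t0" for t n x y z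
    proof -
      have "N (Dop f x y z) (t * \<phi> x y z) \<ge> 1 - e" for x y z
        using t0(2) that by force
      moreover have "Dop (F n) x y z
          = (1 / 3 ^ n) *\<^sub>R Dop f (3 ^ n *\<^sub>R x) (3 ^ n *\<^sub>R y) (3 ^ n *\<^sub>R z)"
        unfolding F_def Dop_rescale by (simp only: g_def Dop_diff_const)
      ultimately show ?thesis
        using N_scaleR_pos[of "1 / 3 ^ n"] by (simp add: phi_term_def mult.left_commute)
    qed
    with t0(1) show ?thesis by blast
  qed
  \<comment> \<open>The factor 1/3 recorded here later leaves room for passing to the limit.\<close>
  have step: "F (Suc n) x - F n x = (1/3) *\<^sub>R Dop (F n) 0 0 x" for n x
  proof -
    have "F (Suc n) x = (1/3) *\<^sub>R F n (3 *\<^sub>R x)" by (simp add: F_def mult.commute)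
    moreover have "Dop (F n) 0 0 x = F n (3 *\<^sub>R x) - 3 *\<^sub>R F n x"
      by (rule Dop_0_0) (simp add: F_def g_def)
    ultimately show ?thesis by (simp add: scaleR_diff_right)
  qed
  have Nstep: "\<exists>t0>0. \<forall>t\<ge>t0. \<forall>n x.
      N (F (Suc n) x - F n x) (t * (1/3 * phi_term \<phi> 0 0 x n)) \<ge> 1 - e"
    if "e > 0" for e
  proof -
    have "N (F (Suc n) x - F n x) (t * (1/3 * phi_term \<phi> 0 0 x n))
        = N (Dop (F n) 0 0 x) (t * phi_term \<phi> 0 0 x n)" for t n x
      unfolding step mult.left_commute[of t] by (rule N_scaleR_pos) simp
    then show ?thesis using ND[OF that] by (simp only:) blast
  qed
  have "\<exists>l. fconverges (\<lambda>n. F n x) l" for x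
  proof -
    have "fCauchy (\<lambda>n. F n x)"
    proof (rule fCauchy_if_N_step_ge)
      show "summable (\<lambda>n. 1/3 * phi_term \<phi> 0 0 x n)"
        using sm by (intro summable_mult)
      show "\<exists>t. \<forall>n. N (F (Suc n) x - F n x) (t * (1/3 * phi_term \<phi> 0 0 x n)) \<ge> 1 - e"
        if "e > 0" for e using Nstep[OF that] by blast
    qed
    then show ?thesis using complete by (simp add: fconvergent_def)
  qed
  then obtain A where A: "\<And>x. fconverges (\<lambda>n. F n x) (A x)" by metis
  have "Dop A x y z = 0" for x y z
  proof (rule fconverges_unique)
    show "fconverges (\<lambda>n. Dop (F n) x y z) (Dop A x y z)" by (rule fconverges_Dop[OF A])
    \<comment> \<open>The terms of the convergent series tend to 0, so \<open>ND\<close> forces this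
      limit.\<close>
    show "fconverges (\<lambda>n. Dop (F n) x y z) 0"
      by (rule fconverges_0_if_N_ge[OF _ summable_LIMSEQ_zero[OF sm]]) (use ND in blast)
  qed
  moreover have "A 0 = 0"
    using A[of 0] fconverges_unique[OF _ fconverges_const] by (simp add: F_def g_def)
  ultimately have "Modules.additive A" by (rule additive_if_Dop_eq_0)
  moreover have "unif_approximates N \<phi> f A"
    unfolding unif_approximates_def unif_tendsto_1_def
  proof (intro allI impI)
    fix e :: real assume e: "e > 0"
    then obtain t0 where t0: "t0 > 0"
      "\<And>t n x. t \<ge> t0 \<Longrightarrow> N (F (Suc n) x - F n x) (t * (1/3 * phi_term \<phi> 0 0 x n)) \<ge> 1 - e"
      using Nstep by blast
    have "N (f x - A x - f 0) (t * phi_tilde \<phi> 0 0 x) \<ge> 1 - e" if "t \<ge> t0" for t x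
    proof -
      \<comment> \<open>The telescoped steps from \<open>F 0 = g\<close> use at most a third of
        \<open>phi_tilde\<close>; the other two thirds absorb the passage to the limit, so the same
        \<open>t0\<close> and \<open>e\<close> remain valid.\<close>
      have "N (g x - A x) (t * phi_tilde \<phi> 0 0 x) \<ge> 1 - e"
      proof (rule N_limit_ge[OF A])
        fix n
        have "F 0 x = g x" by (simp add: F_def)
        moreover have "N (F (Suc n) x - F 0 x) (t * (\<Sum>k=0..<Suc n. 1/3 * phi_term \<phi> 0 0 x k)) \<ge> 1 - e"
          by (rule N_telescope_ge[where X = "\<lambda>n. F n x"]) (use t0(2) that in auto)
        moreover have "t * (\<Sum>k=0..<Suc n. 1/3 * phi_term \<phi> 0 0 x k) \<le> t * (1/3 * phi_tilde \<phi> 0 0 x)"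
          unfolding phi_tilde_def sum_distrib_left[symmetric] atLeast0LessThan
          using that t0(1) nonneg
          by (intro mult_left_mono sum_le_suminf sm) (auto simp: phi_term_def)
        ultimately show "N (F (Suc n) x - g x) (t * (1/3 * phi_tilde \<phi> 0 0 x)) \<ge> 1 - e"
          by (metis N_mono order_trans)
        show "t * (1/3 * phi_tilde \<phi> 0 0 x) < t * phi_tilde \<phi> 0 0 x"
          using phi_tilde_pos[of \<phi>, OF pos sm, of 0 0 x] that t0(1) by simp
      qed (rule e)
      then show ?thesis by (simp add: g_def algebra_simps)
    qed
    with t0(1) show "\<exists>t0>0. \<forall>t\<ge>t0. \<forall>x. 1 - e \<le> N (f x - A x - f 0) (t * phi_tilde \<phi> 0 0 x)"
      by blast
  qed
  ultimately show ?thesis by blast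
qed

end

theorem theorem5p2:
  fixes N :: "'b::real_vector \<Rightarrow> real \<Rightarrow> real"
    and \<phi> :: "'a::real_vector \<Rightarrow> 'a \<Rightarrow> 'a \<Rightarrow> real"
    and f :: "'a \<Rightarrow> 'b"
  assumes "fuzzy_banach N"
    and "\<And>x y z. \<phi> x y z \<ge> 0"
    and "\<And>x y z. summable (phi_term \<phi> x y z)"
    and "unif_approx_affine N \<phi> f"
  shows "(\<exists>!A. affine_map A \<and> A 0 = 0 \<and> unif_approximates N \<phi> f A) \<and>
    (\<forall>A B. affine_map A \<and> unif_approximates N \<phi> f A \<and>
            affine_map B \<and> unif_approximates N \<phi> f B
       \<longrightarrow> (\<exists>c. \<forall>x. B x = A x + c))"
proof -
  interpret fuzzy_banach N by fact
  \<comment> \<open>Equal additive parts leave only the difference \<open>d - c\<close> of the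
    constants.\<close>
  have unique: "\<exists>c. \<forall>x. B x = A x + c"
    if AB: "affine_map A" "unif_approximates N \<phi> f A" "affine_map B" "unif_approximates N \<phi> f B"
    for A B
  proof -
    obtain c a where a: "Modules.additive a" "A = (\<lambda>x. c + a x)"
      using AB(1) unfolding affine_map_def by blast
    obtain d b where b: "Modules.additive b" "B = (\<lambda>x. d + b x)"
      using AB(3) unfolding affine_map_def by blast
    have "a = b"
      using additive_parts_eq[OF assms(3) a(1) b(1)] AB(2,4) a(2) b(2) by blast
    then have "\<forall>x. B x = A x + (d - c)" using a(2) b(2) by simp
    then show ?thesis by blast
  qed
  obtain A where A: "Modules.additive A" "unif_approximates N \<phi> f A"
    using ex_additive_approximant[OF assms(2-4)] by blast
  have affine: "affine_map A"
    unfolding affine_map_def using A(1) by (intro exI[of _ 0] exI[of _ A]) simp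
  have A0: "A 0 = 0" using A(1) by (rule Modules.additive.zero)
  have "\<exists>!A. affine_map A \<and> A 0 = 0 \<and> unif_approximates N \<phi> f A"
  proof (rule ex1I[of _ A])
    fix B assume B: "affine_map B \<and> B 0 = 0 \<and> unif_approximates N \<phi> f B"
    \<comment> \<open>The normalisation at 0 then forces the remaining constant to vanish.\<close>
    then obtain c where c: "\<forall>x. B x = A x + c" using unique[OF affine A(2), of B] by blast
    moreover have "c = 0" using c[rule_format, of 0] A0 B by simp
    ultimately show "B = A" by auto
  qed (use affine A0 A(2) in blast)
  with unique show ?thesis by blast
qed

end
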